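(* Let $H\in\mathbb{R}$ and $C>2(H+\sqrt{1+H^2})$, and let $\Sigma_{H,C}$ be the associated axially symmetric constant mean curvature surface in $S^3$. (i) If $H<0$ and $C=-\frac{1}{H}$, then $\Sigma_{H,C}$ is either properly immersed or it is dense in the region $$\Big\{(x,y,z,w)\in S^3:\ z^2+w^2\le \frac{1}{1+H^2}\Big\}.$$ (ii) If $C\neq-\frac{1}{H}$ (no condition when $H=0$), then $\Sigma_{H,C}$ is either properly immersed or it is dense in the region $$R_{H,C}=\{(x,y,z,w)\in S^3:\ m_{H,C}\le z^2+w^2\le M_{H,C}\},$$ where $$m_{H,C}=\frac{C+2H+2CH^2-\sqrt{C^2-4CH-4}}{2C+2CH^2},\qquad M_{H,C}=\frac{C+2H+2CH^2+\sqrt{C^2-4CH-4}}{2C+2CH^2}.$$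
   Context: $S^3$ is the unit sphere in $\mathbb{R}^4$. For $H\in\mathbb{R}$ and $C>2(H+\sqrt{1+H^2})$ put $T=\frac{\pi}{\sqrt{1+H^2}}$ and $$g(t)=\sqrt{\frac{C-2H}{2+2H^2}+\frac{\sqrt{C^2-4CH-4}}{2+2H^2}\sin(2\sqrt{1+H^2}\,t)},$$ a positive $T$-periodic function satisfying $g'^2+g^2(1+(H+g^{-2})^2)=C$. Let $$\theta(t)=\int_{T/4}^{t}\frac{\sqrt{C}\,g(\tau)\,(H-g(\tau)^{-2})}{g'(\tau)^2+g(\tau)^2}\,d\tau$$ and let $\beta:\mathbb{R}\to\mathbb{R}^2$ be $$\beta=\frac{1}{\sqrt{C g'^2+Cg^2}}\Big(-\sqrt{C}\,g'\cos\theta-(Hg^2+1)\sin\theta,\ \sqrt{C}\,g'\sin\theta-(Hg^2+1)\cos\theta\Big).$$ The surface $\Sigma_{H,C}$ is the one given by the immersion $\phi:\mathbb{R}^2\to S^3$, $$\phi(s,t)=\big(\sqrt{1-|\beta(t)|^2}\cos s,\ \sqrt{1-|\beta(t)|^2}\sin s,\ \beta(t)\big);$$ $\beta$ is called its profile curve. $\Sigma_{H,C}$ is called properly immersed if its profile curve closes up, i.e. $\beta$ is a periodic function of $t$, so that $\phi$ induces a (proper) immersion of a compact torus into $S^3$. $\Sigma_{H,C}$ is dense in a region if the image $\phi(\mathbb{R}^2)$ is a dense subset of that region. *)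

theory Defs
  imports "HOL-Analysis.Analysis"
begin

definition cmc_g :: "real \<Rightarrow> real \<Rightarrow> real \<Rightarrow> real" where
  "cmc_g H C t =
     sqrt ((C - 2 * H) / (2 + 2 * H\<^sup>2)
       + sqrt (C\<^sup>2 - 4 * C * H - 4) / (2 + 2 * H\<^sup>2) * sin (2 * sqrt (1 + H\<^sup>2) * t))"

definition cmc_period :: "real \<Rightarrow> real" where
  "cmc_period H = pi / sqrt (1 + H\<^sup>2)"

(* The interval integral is oriented: for t < T/4 it is minus the integral over (t, T/4). *)
definition cmc_theta :: "real \<Rightarrow> real \<Rightarrow> real \<Rightarrow> real" where
  "cmc_theta H C t =
     (LBINT \<tau>=ereal (cmc_period H / 4)..ereal t.
        sqrt C * cmc_g H C \<tau> * (H - 1 / (cmc_g H C \<tau>)\<^sup>2)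
          / ((deriv (cmc_g H C) \<tau>)\<^sup>2 + (cmc_g H C \<tau>)\<^sup>2))"

definition profile_curve :: "real \<Rightarrow> real \<Rightarrow> real \<Rightarrow> real ^ 2" where
  "profile_curve H C t =
     (let g = cmc_g H C t; g' = deriv (cmc_g H C) t; \<theta> = cmc_theta H C t
      in (1 / sqrt (C * g'\<^sup>2 + C * g\<^sup>2)) *\<^sub>R
           vector [- sqrt C * g' * cos \<theta> - (H * g\<^sup>2 + 1) * sin \<theta>,
                   sqrt C * g' * sin \<theta> - (H * g\<^sup>2 + 1) * cos \<theta>])"

definition cmc_immersion :: "real \<Rightarrow> real \<Rightarrow> real \<times> real \<Rightarrow> real ^ 4" where
  "cmc_immersion H C = (\<lambda>(s, t).
     let \<beta> = profile_curve H C t; r = sqrt (1 - (norm \<beta>)\<^sup>2)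
     in vector [r * cos s, r * sin s, \<beta> $ 1, \<beta> $ 2])"

definition properly_immersed :: "real \<Rightarrow> real \<Rightarrow> bool" where
  "properly_immersed H C \<longleftrightarrow>
     (\<exists>P>0. \<forall>t. profile_curve H C (t + P) = profile_curve H C t)"

definition dense_in_region :: "real \<Rightarrow> real \<Rightarrow> (real ^ 4) set \<Rightarrow> bool" where
  "dense_in_region H C R \<longleftrightarrow>
     range (cmc_immersion H C) \<subseteq> R \<and> R \<subseteq> closure (range (cmc_immersion H C))"

definition sphere3 :: "(real ^ 4) set" where
  "sphere3 = sphere 0 1"

definition m_HC :: "real \<Rightarrow> real \<Rightarrow> real" where
  "m_HC H C =
     (C + 2 * H + 2 * C * H\<^sup>2 - sqrt (C\<^sup>2 - 4 * C * H - 4)) / (2 * C + 2 * C * H\<^sup>2)"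

definition M_HC :: "real \<Rightarrow> real \<Rightarrow> real" where
  "M_HC H C =
     (C + 2 * H + 2 * C * H\<^sup>2 + sqrt (C\<^sup>2 - 4 * C * H - 4)) / (2 * C + 2 * C * H\<^sup>2)"

end

theory Submission
  imports Defs
begin

text \<open>
  Put \<open>u = g\<^sup>2\<close> and identify \<open>\<real>\<^sup>2\<close> with \<open>\<complex>\<close>. The first integral satisfied by \<open>g\<close> turns into
  \<open>|\<beta>|\<^sup>2 = 1 - u/C\<close>, so the values of \<open>|\<beta>|\<^sup>2\<close> fill exactly the interval \<open>[m, M]\<close>. On the other hand
  \<open>\<beta> = -(\<surd>C g' + \<i> (H g\<^sup>2 + 1)) e\<^sup>-\<^sup>\<i>\<^sup>\<theta> / \<surd>(C g'\<^sup>2 + C g\<^sup>2)\<close>, where \<open>g\<close> is \<open>T\<close>-periodic and \<open>\<theta>\<close> increases by a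
  constant \<open>\<Theta>\<close> over each period; hence \<open>\<beta>(t + T) = e\<^sup>-\<^sup>\<i>\<^sup>\<Theta> \<beta>(t)\<close>. If \<open>\<Theta>\<close> is a rational multiple of
  \<open>2\<pi>\<close> the curve closes up; otherwise, by Kronecker's theorem, each point of \<open>\<beta>\<close> has an orbit that is
  dense in its circle. The case \<open>C = -1/H\<close> is the special case \<open>m = 0\<close>.
\<close>

section \<open>Periodic integrands, rotations and norms\<close>

lemma norm_vec_2_sq: "(norm (v :: real ^ 2))\<^sup>2 = (v $ 1)\<^sup>2 + (v $ 2)\<^sup>2"
  by (simp add: norm_vec_def L2_set_def sum_2)

lemma norm_vec_4_sq: "(norm (p :: real ^ 4))\<^sup>2 = (p $ 1)\<^sup>2 + (p $ 2)\<^sup>2 + (p $ 3)\<^sup>2 + (p $ 4)\<^sup>2"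
  by (simp add: norm_vec_def L2_set_def sum_4)

text \<open>The integral over a window of length \<open>T\<close> has zero derivative in its
  position, so it is constant, and placing the window at \<open>c\<close> gives the constant.
  Differentiating treats both orientations of the integral alike.\<close>

lemma interval_integral_add_period:
  fixes f :: "real \<Rightarrow> 'a::euclidean_space"
  assumes cont: "continuous_on UNIV f" and per: "\<And>x. f (x + T) = f x"
  shows "(LBINT x=ereal c..ereal (t + T). f x) =
         (LBINT x=ereal c..ereal t. f x) + (LBINT x=ereal c..ereal (c + T). f x)"
proof -
  let ?F = "\<lambda>t. LBINT x=ereal c..ereal t. f x"
  have deriv: "(?F has_vector_derivative f x) (at x)" for x
  proof -
    \<comment> \<open>This interval contains \<open>c\<close> and has \<open>x\<close> in its
      interior, so the derivative within it is the full derivative.\<close>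
    let ?a = "min c x - 1" and ?b = "max c x + 1"
    have "(?F has_vector_derivative f x) (at x within {?a..?b})"
      by (intro interval_integral_FTC2 continuous_on_subset[OF cont]) auto
    moreover have "at x within {?a..?b} = at x"
      by (rule at_within_interior) (simp add: min_def max_def)
    ultimately show ?thesis by simp
  qed
  have shift: "((\<lambda>x. ?F (x + T)) has_vector_derivative f x) (at x)" for x
  proof -
    have "((\<lambda>x. x + T) has_vector_derivative 1) (at x)"
      by (auto intro!: derivative_eq_intros)
    from vector_diff_chain_at[OF this deriv] show ?thesis
      by (simp add: o_def per)
  qed
  have "((\<lambda>x. ?F (x + T) - ?F x) has_vector_derivative 0) (at x)" for x
    using has_vector_derivative_diff[OF shift deriv] by simp
  then obtain k where k: "\<And>x. ?F (x + T) - ?F x = k"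
    using has_vector_derivative_zero_constant[of UNIV "\<lambda>x. ?F (x + T) - ?F x"] by auto
  show ?thesis
    using k[of t] k[of c] by (simp add: algebra_simps)
qed

text \<open>A chord of the unit circle is no longer than its arc: the chord has length 2 |sin ((x -
  y) / 2)|.\<close>

lemma norm_cis_diff_le: "norm (cis x - cis y) \<le> \<bar>x - y\<bar>"
proof -
  have "cis x - cis y = cis y * (cis (x - y) - 1)"
    by (simp add: algebra_simps cis_mult)
  then have "norm (cis x - cis y) = 2 * \<bar>sin ((x - y) / 2)\<bar>"
    using dist_exp_i_1[of "x - y"] by (simp add: norm_mult cis_conv_exp)
  also have "\<dots> \<le> \<bar>x - y\<bar>"
    using abs_sin_x_le_abs_x[of "(x - y) / 2"] by simp
  finally show ?thesis .
qed

text \<open>One-dimensional Kronecker theorem on the circle through \<open>z\<close>: some multiple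
  of the rotation angle comes close, modulo 2 pi, to the angle from \<open>z\<close> to
  \<open>q\<close>.\<close>

lemma irrational_rotation_dense:
  fixes z q :: complex
  assumes irr: "\<alpha> / (2 * pi) \<notin> \<rat>" and norm_eq: "norm z = norm q" and "\<epsilon> > 0"
  obtains n :: nat where "norm (cis (real n * \<alpha>) * z - q) < \<epsilon>"
proof (cases "z = 0")
  case True
  then show ?thesis
    using norm_eq \<open>\<epsilon> > 0\<close> by (intro that[of 0]) auto
next
  case False
  then have pos: "norm z > 0" by simp
  define \<phi> where "\<phi> = Arg (q / z)"
  have "norm (q / z) = 1" using norm_eq pos by (simp add: norm_divide)
  then have "q / z = cis \<phi>"
    unfolding \<phi>_def by (metis cis_Arg norm_zero sgn_div_norm scaleR_one inverse_1 zero_neq_one)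
  then have q: "q = cis \<phi> * z" using False by (simp add: field_simps)
  \<comment> \<open>Fractional parts measure angles in full turns, whence 2 pi;
    \<open>norm z\<close> accounts for the radius of the circle.\<close>
  have "\<epsilon> / (norm z * (2 * pi)) > 0" using pos \<open>\<epsilon> > 0\<close> by simp
  then obtain h k where k: "k > 0"
    and hk: "\<bar>of_int k * (\<alpha> / (2 * pi)) - of_int h - \<phi> / (2 * pi)\<bar> < \<epsilon> / (norm z * (2 * pi))"
    using sequence_of_fractional_parts_is_dense[OF irr] by metis
  define n where "n = nat k"
  have n: "of_int k = real n" using k by (simp add: n_def)
  let ?x = "real n * \<alpha> - 2 * pi * of_int h - \<phi>"
  have "of_int k * (\<alpha> / (2 * pi)) - of_int h - \<phi> / (2 * pi) = ?x / (2 * pi)"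
    by (simp add: n field_simps)
  then have "\<bar>?x\<bar> / (2 * pi) < (\<epsilon> / norm z) / (2 * pi)"
    using hk by simp
  then have close: "\<bar>?x\<bar> < \<epsilon> / norm z"
    by (simp only: divide_less_cancel) simp
  have "cis (real n * \<alpha>) = cis (real n * \<alpha> - 2 * pi * of_int h) * cis (2 * pi * of_int h)"
    by (simp only: cis_mult diff_add_cancel)
  then have "cis (real n * \<alpha>) = cis (real n * \<alpha> - 2 * pi * of_int h)"
    by (simp only: cis_multiple_2pi[OF Ints_of_int] mult_1_right)
  then have "norm (cis (real n * \<alpha>) * z - q) =
      norm (cis (real n * \<alpha> - 2 * pi * of_int h) - cis \<phi>) * norm z"
    by (simp add: q norm_mult flip: left_diff_distrib)
  also have "\<dots> \<le> \<bar>?x\<bar> * norm z"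
    by (intro mult_right_mono norm_cis_diff_le) simp
  also have "\<dots> < \<epsilon>"
    using close pos by (simp add: field_simps)
  finally show ?thesis by (rule that)
qed

section \<open>The profile curve\<close>

definition cmc_u :: "real \<Rightarrow> real \<Rightarrow> real \<Rightarrow> real" where
  "cmc_u H C t = (C - 2 * H) / (2 + 2 * H\<^sup>2)
     + sqrt (C\<^sup>2 - 4 * C * H - 4) / (2 + 2 * H\<^sup>2) * sin (2 * sqrt (1 + H\<^sup>2) * t)"

definition profile_complex :: "real \<Rightarrow> real \<Rightarrow> real \<Rightarrow> complex" where
  "profile_complex H C t = Complex (profile_curve H C t $ 1) (profile_curve H C t $ 2)"

text \<open>\<open>cmc_theta\<close> vanishes at T/4, so this value is its increment over one
  period.\<close>

definition cmc_rotation :: "real \<Rightarrow> real \<Rightarrow> real" where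
  "cmc_rotation H C = cmc_theta H C (cmc_period H / 4 + cmc_period H)"

lemma cmc_g_eq: "cmc_g H C t = sqrt (cmc_u H C t)"
  by (simp add: cmc_g_def cmc_u_def)

lemma norm_profile_complex: "norm (profile_complex H C t) = norm (profile_curve H C t)"
  by (simp add: profile_complex_def cmod_def norm_vec_def L2_set_def sum_2)

lemma profile_curve_eqI:
  "profile_complex H C s = profile_complex H C t \<Longrightarrow> profile_curve H C s = profile_curve H C t"
  by (simp add: profile_complex_def vec_eq_iff forall_2)

text \<open>The angle enters only through a unimodular factor: it does not affect the modulus, and
  shifting it rotates the curve.\<close>

lemma profile_complex_eq:
  "profile_complex H C t =
     - Complex (sqrt C * deriv (cmc_g H C) t) (H * (cmc_g H C t)\<^sup>2 + 1) * cis (- cmc_theta H C t) /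
       sqrt (C * (deriv (cmc_g H C) t)\<^sup>2 + C * (cmc_g H C t)\<^sup>2)"
  by (simp add: profile_complex_def profile_curve_def Let_def complex_eq_iff algebra_simps
        diff_divide_distrib add_divide_distrib)

section \<open>Constants of the oscillation of g^2\<close>

locale cmc_params =
  fixes H C :: real
  assumes C_gt: "C > 2 * (H + sqrt (1 + H\<^sup>2))"
begin

abbreviation "T \<equiv> cmc_period H"
abbreviation "u \<equiv> cmc_u H C"
abbreviation "g \<equiv> cmc_g H C"

text \<open>In terms of \<open>u\<close>: \<open>w\<close> is half the angular frequency,
  \<open>a\<close> the mean and \<open>b\<close> the amplitude.\<close>

definition w where "w = sqrt (1 + H\<^sup>2)"
definition a where "a = (C - 2 * H) / (2 + 2 * H\<^sup>2)"
definition b where "b = sqrt (C\<^sup>2 - 4 * C * H - 4) / (2 + 2 * H\<^sup>2)"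

lemma w_sq: "w\<^sup>2 = 1 + H\<^sup>2"
  by (simp add: w_def)

lemma w_pos: "w > 0"
  by (simp add: w_def add_pos_nonneg)

lemma denominator_eq: "2 + 2 * H\<^sup>2 = 2 * w\<^sup>2"
  by (simp add: w_sq)

lemma a_eq: "a = (C - 2 * H) / (2 * w\<^sup>2)"
  by (simp add: a_def denominator_eq)

lemma b_eq: "b = sqrt (C\<^sup>2 - 4 * C * H - 4) / (2 * w\<^sup>2)"
  by (simp add: b_def denominator_eq)

lemma T_pos: "T > 0"
  using w_pos by (simp add: cmc_period_def w_def)

lemma C_gt_w: "C > 2 * H + 2 * w"
  using C_gt by (simp add: w_def)

lemma C_pos: "C > 0"
proof -
  have "\<bar>H\<bar> \<le> w" unfolding w_def by (rule real_le_rsqrt) simp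
  then show ?thesis using C_gt_w by linarith
qed

text \<open>The discriminant is the difference of squares (C - 2H)^2 - (2w)^2.\<close>

lemma discriminant_pos: "C\<^sup>2 - 4 * C * H - 4 > 0"
proof -
  have "(2 * w)\<^sup>2 < (C - 2 * H)\<^sup>2"
    using C_gt_w w_pos by (intro power_strict_mono) auto
  then show ?thesis
    by (simp add: power_mult_distrib power2_diff w_sq algebra_simps)
qed

lemma b_pos: "b > 0"
  using discriminant_pos w_pos by (simp add: b_eq)

lemma a_pos: "a > 0"
  using C_gt_w w_pos by (simp add: a_eq)

text \<open>This relation yields both the positivity of \<open>u\<close> (through
  \<open>b_less_a\<close>) and the constant term of the first integral.\<close>

lemma a_b_sq: "w\<^sup>2 * (a\<^sup>2 - b\<^sup>2) = 1"
proof -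
  have "a\<^sup>2 - b\<^sup>2 = ((C - 2 * H)\<^sup>2 - (C\<^sup>2 - 4 * C * H - 4)) / (2 * w\<^sup>2)\<^sup>2"
    unfolding a_eq b_eq power_divide using discriminant_pos by (simp only: real_sqrt_pow2 less_imp_le diff_divide_distrib)
  also have "(C - 2 * H)\<^sup>2 - (C\<^sup>2 - 4 * C * H - 4) = 4 * w\<^sup>2"
    unfolding w_sq by (simp add: power2_eq_square algebra_simps)
  finally show ?thesis
    using w_pos by (simp add: power2_eq_square)
qed

lemma b_less_a: "b < a"
proof (rule power2_less_imp_less)
  have "a\<^sup>2 - b\<^sup>2 > 0"
    by (rule ccontr) (use a_b_sq w_pos mult_nonneg_nonpos[of "w\<^sup>2" "a\<^sup>2 - b\<^sup>2"] in auto)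
  then show "b\<^sup>2 < a\<^sup>2" by simp
qed (use a_pos in simp)

lemma u_eq: "u t = a + b * sin (2 * w * t)"
  by (simp add: cmc_u_def a_def b_def w_def)

lemma u_bounds: "a - b \<le> u t" "u t \<le> a + b"
proof -
  have "\<bar>b * sin (2 * w * t)\<bar> \<le> b * 1"
    unfolding abs_mult using b_pos by (intro mult_mono) auto
  then show "a - b \<le> u t" "u t \<le> a + b"
    unfolding u_eq by linarith+
qed

lemma u_pos: "u t > 0"
  using u_bounds(1)[of t] b_less_a by linarith

lemma g_sq: "(g t)\<^sup>2 = u t"
  using u_pos[of t] by (simp add: cmc_g_eq)

section \<open>The first integral and the modulus of the profile curve\<close>

lemma g_has_derivative:
  "(g has_real_derivative (w * b * cos (2 * w * t) / sqrt (u t))) (at t)"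
proof -
  have u': "(u has_real_derivative (2 * w * b * cos (2 * w * t))) (at t)"
    unfolding u_eq[abs_def] by (auto intro!: derivative_eq_intros)
  have "((\<lambda>t. sqrt (u t)) has_real_derivative
      inverse (sqrt (u t)) / 2 * (2 * w * b * cos (2 * w * t))) (at t)"
    by (rule DERIV_chain2[OF DERIV_real_sqrt[OF u_pos] u'])
  then show ?thesis
    by (simp add: cmc_g_eq[abs_def] field_simps)
qed

lemma deriv_g: "deriv g t = w * b * cos (2 * w * t) / sqrt (u t)"
  by (rule DERIV_imp_deriv[OF g_has_derivative])

text \<open>The first integral g'^2 + g^2 (1 + (H + g^-2)^2) = C, multiplied by u = g^2 to clear the
  denominators.\<close>

lemma first_integral: "u t * ((deriv g t)\<^sup>2 + u t) = C * u t - (H * u t + 1)\<^sup>2"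
proof -
  let ?s = "sin (2 * w * t)" and ?c = "cos (2 * w * t)"
  have a: "C = 2 * w\<^sup>2 * a + 2 * H" using w_pos by (simp add: a_eq)
  have "u t * ((deriv g t)\<^sup>2 + u t) = (w * b * ?c)\<^sup>2 + (u t)\<^sup>2"
    using u_pos[of t] by (simp add: deriv_g power_divide distrib_left power2_eq_square[of "u t"])
  also have "(w * b * ?c)\<^sup>2 = w\<^sup>2 * b\<^sup>2 * (1 - ?s\<^sup>2)"
    by (simp only: power_mult_distrib cos_squared_eq)
  also have "w\<^sup>2 * b\<^sup>2 * (1 - ?s\<^sup>2) = w\<^sup>2 * b\<^sup>2 - w\<^sup>2 * (u t - a)\<^sup>2"
    unfolding u_eq by algebra
  also have "w\<^sup>2 * b\<^sup>2 - w\<^sup>2 * (u t - a)\<^sup>2 + (u t)\<^sup>2 = C * u t - (H * u t + 1)\<^sup>2"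
  proof -
    \<comment> \<open>With the sine eliminated, a polynomial identity modulo three relations
      remains; \<open>B\<close> stands for the square of \<open>b\<close>.\<close>
    have "W * B - W * (U - A)\<^sup>2 + U\<^sup>2 = X * U - (H * U + 1)\<^sup>2"
      if "W * (A\<^sup>2 - B) = 1" "W = 1 + H\<^sup>2" "X = 2 * W * A + 2 * H" for A B U W X :: real
      using that by algebra
    from this[OF a_b_sq w_sq a] show ?thesis .
  qed
  finally show ?thesis .
qed

text \<open>By the first integral, the numerator C g'^2 + (H u + 1)^2 equals (C - u)(g'^2 + u), and
  the second factor cancels.\<close>

lemma norm_profile_sq: "(norm (profile_curve H C t))\<^sup>2 = 1 - u t / C"
proof -
  let ?D = "(deriv g t)\<^sup>2 + u t"
  have D: "?D > 0" using u_pos[of t] by (simp add: add_nonneg_pos)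
  have "(norm (profile_curve H C t))\<^sup>2 =
      ((sqrt C * deriv g t)\<^sup>2 + (H * u t + 1)\<^sup>2) / (C * (deriv g t)\<^sup>2 + C * u t)"
    using C_pos D u_pos[of t]
    by (simp add: profile_complex_eq norm_mult norm_divide power_divide power_mult_distrib cmod_power2 g_sq
        flip: norm_profile_complex)
  also have "\<dots> = (C * (deriv g t)\<^sup>2 + (C * u t - u t * ?D)) / (C * ?D)"
    unfolding first_integral using C_pos by (simp add: power_mult_distrib distrib_left)
  also have "\<dots> = (C * ?D - u t * ?D) / (C * ?D)"
    by (simp add: algebra_simps)
  also have "\<dots> = 1 - u t / C"
    using C_pos D by (simp add: diff_divide_distrib)
  finally show ?thesis .
qed

section \<open>Periodicity and the rotation per period\<close>

lemma two_w_T: "2 * w * T = 2 * pi"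
  using w_pos by (simp add: cmc_period_def w_def)

lemma u_period: "u (t + T) = u t"
  by (simp add: u_eq distrib_left two_w_T)

lemma g_period: "g (t + T) = g t"
  by (simp add: cmc_g_eq u_period)

lemma deriv_g_period: "deriv g (t + T) = deriv g t"
  by (simp add: deriv_g u_period distrib_left two_w_T)

text \<open>The integrand is periodic because \<open>g\<close> and its derivative are, and
  continuous because \<open>u\<close> stays positive.\<close>

lemma theta_period: "cmc_theta H C (t + T) = cmc_theta H C t + cmc_rotation H C"
proof -
  let ?f = "\<lambda>\<tau>. sqrt C * g \<tau> * (H - 1 / (g \<tau>)\<^sup>2) / ((deriv g \<tau>)\<^sup>2 + (g \<tau>)\<^sup>2)"
  have u_cont: "continuous_on UNIV u"
    unfolding u_eq[abs_def] by (intro continuous_intros)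
  have "(deriv g t)\<^sup>2 + u t \<noteq> 0" for t
    using u_pos[of t] zero_le_power2[of "deriv g t"] by linarith
  moreover have "u t \<noteq> 0" for t
    using u_pos[of t] by simp
  ultimately have "continuous_on UNIV ?f"
    unfolding g_sq unfolding deriv_g cmc_g_eq
    by (intro continuous_intros u_cont) auto
  then show ?thesis
    unfolding cmc_theta_def cmc_rotation_def
    by (rule interval_integral_add_period) (simp add: g_period deriv_g_period)
qed

lemma profile_period:
  "profile_complex H C (t + T) = cis (- cmc_rotation H C) * profile_complex H C t"
  by (simp add: profile_complex_eq g_period deriv_g_period theta_period cis_mult add.commute)

lemma profile_multiple_period:
  "profile_complex H C (t + real n * T) = cis (real n * (- cmc_rotation H C)) * profile_complex H C t"
proof (induction n)
  case (Suc n)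
  have "t + real (Suc n) * T = (t + real n * T) + T" by (simp add: algebra_simps)
  then show ?case
    by (simp only: profile_period Suc.IH mult.assoc[symmetric] cis_mult) (simp add: algebra_simps)
qed simp

text \<open>If one period rotates the curve by p/q of a full turn, then q periods make p full
  turns.\<close>

lemma properly_immersed_if_rational:
  assumes "- cmc_rotation H C / (2 * pi) \<in> \<rat>"
  shows "properly_immersed H C"
proof -
  obtain p q where q: "q > 0" and pq: "- cmc_rotation H C / (2 * pi) = of_int p / of_int q"
    using assms by (metis Rats_cases')
  have "of_int q * (- cmc_rotation H C) = 2 * pi * of_int p"
    using pq q by (simp add: field_simps)
  then have "real (nat q) * (- cmc_rotation H C) = 2 * pi * of_int p"
    using q by simp
  then have "profile_complex H C (t + real (nat q) * T) = profile_complex H C t" for t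
    by (simp only: profile_multiple_period cis_multiple_2pi[OF Ints_of_int]) simp
  then have "profile_curve H C (t + real (nat q) * T) = profile_curve H C t" for t
    by (rule profile_curve_eqI)
  moreover have "real (nat q) * T > 0"
    using q T_pos by simp
  ultimately show ?thesis
    unfolding properly_immersed_def by blast
qed

section \<open>The range of the squared modulus\<close>

lemma m_HC_eq: "m_HC H C = 1 - (a + b) / C"
proof -
  have "2 * C + 2 * C * H\<^sup>2 = C * (2 * w\<^sup>2)" unfolding w_sq by (simp add: algebra_simps)
  then have "m_HC H C = (C * (2 * w\<^sup>2) - ((C - 2 * H) + sqrt (C\<^sup>2 - 4 * C * H - 4))) / (C * (2 * w\<^sup>2))"
    unfolding m_HC_def by (simp add: algebra_simps)
  then show ?thesis
    using C_pos w_pos by (simp add: a_eq b_eq diff_divide_distrib mult.commute add_divide_distrib)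
qed

lemma M_HC_eq: "M_HC H C = 1 - (a - b) / C"
proof -
  have "2 * C + 2 * C * H\<^sup>2 = C * (2 * w\<^sup>2)" unfolding w_sq by (simp add: algebra_simps)
  then have "M_HC H C = (C * (2 * w\<^sup>2) - ((C - 2 * H) - sqrt (C\<^sup>2 - 4 * C * H - 4))) / (C * (2 * w\<^sup>2))"
    unfolding M_HC_def by (simp add: algebra_simps)
  then show ?thesis
    using C_pos w_pos by (simp add: a_eq b_eq diff_divide_distrib mult.commute)
qed

text \<open>Since 1 - u/C decreases in u, the maximum a + b of \<open>u\<close> gives the lower
  bound and the minimum a - b the upper one.\<close>

lemma norm_profile_sq_bounds:
  "m_HC H C \<le> (norm (profile_curve H C t))\<^sup>2" "(norm (profile_curve H C t))\<^sup>2 \<le> M_HC H C"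
  unfolding norm_profile_sq m_HC_eq M_HC_eq using u_bounds[of t] C_pos
  by (simp_all add: divide_right_mono)

lemma norm_profile_attained:
  assumes "m_HC H C \<le> r" "r \<le> M_HC H C"
  obtains t where "(norm (profile_curve H C t))\<^sup>2 = r"
proof -
  \<comment> \<open>The value of sin (2wt) that solves 1 - u/C = r.\<close>
  define y where "y = (C * (1 - r) - a) / b"
  have "1 - r \<le> (a + b) / C" "(a - b) / C \<le> 1 - r"
    using assms unfolding m_HC_eq M_HC_eq by linarith+
  then have "C * (1 - r) \<le> a + b" "a - b \<le> C * (1 - r)"
    using C_pos by (simp_all only: pos_le_divide_eq pos_divide_le_eq mult.commute)
  then have y: "-1 \<le> y" "y \<le> 1"
    unfolding y_def pos_le_divide_eq[OF b_pos] pos_divide_le_eq[OF b_pos] by linarith+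
  have "u (arcsin y / (2 * w)) = a + b * sin (arcsin y)"
    using w_pos by (simp add: u_eq)
  also have "\<dots> = C * (1 - r)"
    using b_pos y by (simp add: y_def)
  finally have "(norm (profile_curve H C (arcsin y / (2 * w))))\<^sup>2 = r"
    using C_pos by (simp add: norm_profile_sq)
  then show ?thesis by (rule that)
qed

section \<open>Density in the region\<close>

abbreviation "region \<equiv>
  {p \<in> sphere3. m_HC H C \<le> (p $ 3)\<^sup>2 + (p $ 4)\<^sup>2 \<and> (p $ 3)\<^sup>2 + (p $ 4)\<^sup>2 \<le> M_HC H C}"

lemma immersion_nth:
  "cmc_immersion H C (s, t) $ 1 = sqrt (u t / C) * cos s"
  "cmc_immersion H C (s, t) $ 2 = sqrt (u t / C) * sin s"
  "cmc_immersion H C (s, t) $ 3 = profile_curve H C t $ 1"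
  "cmc_immersion H C (s, t) $ 4 = profile_curve H C t $ 2"
  by (simp_all add: cmc_immersion_def Let_def norm_profile_sq vector_def)

lemma immersion_in_region: "range (cmc_immersion H C) \<subseteq> region"
proof clarify
  fix s t
  let ?p = "cmc_immersion H C (s, t)"
  have z: "(?p $ 3)\<^sup>2 + (?p $ 4)\<^sup>2 = (norm (profile_curve H C t))\<^sup>2"
    by (simp add: immersion_nth norm_vec_2_sq)
  have "(?p $ 1)\<^sup>2 + (?p $ 2)\<^sup>2 = u t / C * ((cos s)\<^sup>2 + (sin s)\<^sup>2)"
    using u_pos[of t] C_pos by (simp add: immersion_nth power_mult_distrib distrib_left del: sin_cos_squared_add2)
  then have "(norm ?p)\<^sup>2 = 1"
    using z by (simp add: norm_vec_4_sq norm_profile_sq)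
  then have "norm ?p = 1"
    by (simp add: power2_eq_1_iff) (use norm_ge_zero[of ?p] in linarith)
  then have "?p \<in> sphere3"
    by (simp add: sphere3_def)
  then show "?p \<in> sphere3 \<and> m_HC H C \<le> (?p $ 3)\<^sup>2 + (?p $ 4)\<^sup>2 \<and> (?p $ 3)\<^sup>2 + (?p $ 4)\<^sup>2 \<le> M_HC H C"
    using z norm_profile_sq_bounds by simp
qed

text \<open>Choose \<open>t\<close> to match the modulus of the last two coordinates of
  \<open>p\<close> and \<open>s\<close> to match the first two exactly; adding whole periods to
  \<open>t\<close> then rotates the profile point towards \<open>q\<close>.\<close>

lemma region_in_closure_if_irrational:
  assumes irr: "- cmc_rotation H C / (2 * pi) \<notin> \<rat>"
  shows "region \<subseteq> closure (range (cmc_immersion H C))"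
proof
  fix p assume p: "p \<in> region"
  obtain t where t: "(norm (profile_curve H C t))\<^sup>2 = (p $ 3)\<^sup>2 + (p $ 4)\<^sup>2"
    using p norm_profile_attained by (metis (mono_tags, lifting) mem_Collect_eq)
  define q where "q = Complex (p $ 3) (p $ 4)"
  have norm_eq: "norm (profile_complex H C t) = norm q"
    by (rule power2_eq_imp_eq) (simp_all add: t norm_profile_complex q_def cmod_power2)
  have "norm p = 1" using p by (simp add: sphere3_def)
  then have "(p $ 1)\<^sup>2 + (p $ 2)\<^sup>2 = u t / C"
    using t norm_vec_4_sq[of p] norm_profile_sq[of t] by simp
  then have "norm (Complex (p $ 1) (p $ 2)) = sqrt (u t / C)"
    by (simp add: cmod_def)
  then have "Complex (p $ 1) (p $ 2) = rcis (sqrt (u t / C)) (Arg (Complex (p $ 1) (p $ 2)))"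
    by (metis rcis_cmod_Arg)
  then obtain s where s: "p $ 1 = sqrt (u t / C) * cos s" "p $ 2 = sqrt (u t / C) * sin s"
    by (metis complex.sel Re_rcis Im_rcis)
  show "p \<in> closure (range (cmc_immersion H C))"
    unfolding closure_approachable
  proof (intro allI impI)
    fix e :: real assume "e > 0"
    obtain n where n: "norm (cis (real n * (- cmc_rotation H C)) * profile_complex H C t - q) < e"
      by (rule irrational_rotation_dense[OF irr norm_eq \<open>e > 0\<close>])
    let ?t = "t + real n * T" and ?y = "cmc_immersion H C (s, t + real n * T)"
    \<comment> \<open>Rotation preserves the modulus and hence \<open>u\<close>, so the first two
      coordinates stay exact and the whole error lies in the last two.\<close>
    have "norm (profile_curve H C ?t) = norm (profile_curve H C t)"
      unfolding norm_profile_complex[symmetric] by (simp add: profile_multiple_period norm_mult)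
    then have "1 - u ?t / C = 1 - u t / C"
      unfolding norm_profile_sq[symmetric] by simp
    then have "u ?t / C = u t / C"
      by linarith
    then have "?y $ 1 = p $ 1" "?y $ 2 = p $ 2"
      by (simp_all only: immersion_nth s)
    then have "(norm (?y - p))\<^sup>2 = (norm (profile_complex H C ?t - q))\<^sup>2"
      by (simp add: norm_vec_4_sq immersion_nth cmod_power2 profile_complex_def q_def)
    then have "dist ?y p < e"
      using n by (simp add: dist_norm profile_multiple_period)
    then show "\<exists>y\<in>range (cmc_immersion H C). dist y p < e" by blast
  qed
qed

lemma properly_immersed_or_dense: "properly_immersed H C \<or> dense_in_region H C region"
  using properly_immersed_if_rational immersion_in_region region_in_closure_if_irrational
  unfolding dense_in_region_def by blast

section \<open>The case C = -1/H\<close>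

lemma special_bounds:
  assumes "H < 0" "C = - 1 / H"
  shows "m_HC H C = 0" "M_HC H C = 1 / (1 + H\<^sup>2)"
proof -
  \<comment> \<open>This turns the discriminant into the square of \<open>C\<close> and makes 2H +
    2CH^2 = 2H (1 + CH) vanish.\<close>
  have CH: "C * H = - 1" using assms by simp
  then have disc: "C\<^sup>2 - 4 * C * H - 4 = C\<^sup>2" by (simp add: mult.assoc)
  have "C * H\<^sup>2 = - H" using CH by (simp add: power2_eq_square flip: mult.assoc)
  then have num: "2 * H + 2 * C * H\<^sup>2 = 0" by simp
  have sq: "sqrt (C\<^sup>2) = C"
    using C_pos by (intro real_sqrt_unique) auto
  have "m_HC H C = (2 * H + 2 * C * H\<^sup>2) / (2 * C + 2 * C * H\<^sup>2)"
    unfolding m_HC_def disc sq by (rule arg_cong2[where f = "(/)"]) linarith+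
  then show "m_HC H C = 0"
    unfolding num by simp
  have "M_HC H C = (2 * C * 1) / (2 * C * (1 + H\<^sup>2))"
    unfolding M_HC_def disc sq
  proof (rule arg_cong2[where f = "(/)"])
    show "C + 2 * H + 2 * C * H\<^sup>2 + C = 2 * C * 1"
      using num by linarith
    show "2 * C + 2 * C * H\<^sup>2 = 2 * C * (1 + H\<^sup>2)"
      by (simp add: distrib_left)
  qed
  then show "M_HC H C = 1 / (1 + H\<^sup>2)"
    using C_pos by simp
qed

end

theorem theorem5p2:
  fixes H C :: real
  assumes "C > 2 * (H + sqrt (1 + H\<^sup>2))"
  shows
    "(H < 0 \<and> C = - 1 / H \<longrightarrow>
        properly_immersed H C \<or>
        dense_in_region H C {p \<in> sphere3. (p $ 3)\<^sup>2 + (p $ 4)\<^sup>2 \<le> 1 / (1 + H\<^sup>2)}) \<and>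
     (H = 0 \<or> C \<noteq> - 1 / H \<longrightarrow>
        properly_immersed H C \<or>
        dense_in_region H C
          {p \<in> sphere3. m_HC H C \<le> (p $ 3)\<^sup>2 + (p $ 4)\<^sup>2 \<and> (p $ 3)\<^sup>2 + (p $ 4)\<^sup>2 \<le> M_HC H C})"
proof -
  interpret cmc_params H C
    using assms by unfold_locales
  show ?thesis
  proof (intro conjI impI)
    assume "H < 0 \<and> C = - 1 / H"
    then have m: "m_HC H C = 0" and M: "M_HC H C = 1 / (1 + H\<^sup>2)"
      using special_bounds by blast+
    \<comment> \<open>With m = 0 the lower bound holds for any sum of two squares.\<close>
    have "region = {p \<in> sphere3. (p $ 3)\<^sup>2 + (p $ 4)\<^sup>2 \<le> 1 / (1 + H\<^sup>2)}"
      unfolding m M by simp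
    then show "properly_immersed H C \<or>
        dense_in_region H C {p \<in> sphere3. (p $ 3)\<^sup>2 + (p $ 4)\<^sup>2 \<le> 1 / (1 + H\<^sup>2)}"
      using properly_immersed_or_dense by simp
  qed (rule properly_immersed_or_dense)
qed

end
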